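(* For all integers $n\geq 0$ and $k\geq 2$ there exists a bijection $\Phi:\mathrm{BNW}_{n+1}^{(k)}\to\mathrm{NC}_{n+1}^{(k)}$ such that $P$ and $\Phi(P)$ have the same number of blocks for every $P\in\mathrm{BNW}_{n+1}^{(k)}$. In particular $\sum_{P\in\mathrm{BNW}_{n+1}^{(k)}}t^{|P|}=\sum_{P\in\mathrm{NC}_{n+1}^{(k)}}t^{|P|}$, where $|P|$ is the number of blocks.
   Context: Here partitions are partitions of $\{0,1,\dots,n\}$. The arc diagram of a partition $P$ has an arc $(i,j)$, $i<j$, whenever $i,j$ lie in the same block and that block contains no $l$ with $i<l<j$ (and a loop at $i$ if $\{i\}$ is a block). A $k$-crossing is a set of $k$ arcs $(i_1,j_1),\dots,(i_k,j_k)$ with $i_1<\cdots<i_k<j_1<\cdots<j_k$; a weak $k$-crossing is a set of $k$ arcs with $i_1<\cdots<i_k=j_1<j_2<\cdots<j_k$; together they are the enhanced $k$-crossings. The block containing $0$ is the red block; its elements and the arcs joining two of its elements are red, all other elements and arcs are black. An (enhanced) $k$-crossing is black if all its arcs are black. $\mathrm{NC}_{n+1}^{(k)}$ is the set of partitions of $\{0,\dots,n\}$ with no $k$-crossing, and $\mathrm{BNW}_{n+1}^{(k)}$ is the set of partitions of $\{0,\dots,n\}$ with no black $k$-crossing and no black weak $k$-crossing. *)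

theory Defs
  imports "HOL-Library.Disjoint_Sets" "HOL-Computational_Algebra.Polynomial"
begin

definition arcs :: "nat set set \<Rightarrow> (nat \<times> nat) set" where
  "arcs P =
     {(i, j). i < j \<and> (\<exists>B\<in>P. i \<in> B \<and> j \<in> B \<and> (\<forall>l\<in>B. \<not> (i < l \<and> l < j)))}
     \<union> {(i, i) | i. {i} \<in> P}"

definition crossing :: "nat \<Rightarrow> (nat \<times> nat) set \<Rightarrow> bool" where
  "crossing k X \<longleftrightarrow>
     (\<exists>i j :: nat \<Rightarrow> nat. strict_mono_on {1..k} i \<and> strict_mono_on {1..k} j \<and> i k < j 1 \<and>
        X = (\<lambda>r. (i r, j r)) ` {1..k})"

definition weak_crossing :: "nat \<Rightarrow> (nat \<times> nat) set \<Rightarrow> bool" where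
  "weak_crossing k X \<longleftrightarrow>
     (\<exists>i j :: nat \<Rightarrow> nat. strict_mono_on {1..k} i \<and> strict_mono_on {1..k} j \<and> i k = j 1 \<and>
        X = (\<lambda>r. (i r, j r)) ` {1..k})"

text \<open>Well defined only when \<open>P\<close> partitions a set containing \<open>0\<close>.\<close>

definition red_block :: "nat set set \<Rightarrow> nat set" where
  "red_block P = (THE B. B \<in> P \<and> 0 \<in> B)"

definition red_arcs :: "nat set set \<Rightarrow> (nat \<times> nat) set" where
  "red_arcs P = {(i, j) \<in> arcs P. i \<in> red_block P \<and> j \<in> red_block P}"

definition black_arcs :: "nat set set \<Rightarrow> (nat \<times> nat) set" where
  "black_arcs P = arcs P - red_arcs P"

text \<open>The argument \<open>m\<close> is the size of the ground set, so \<open>m = n + 1\<close> gives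
  partitions of \<open>{0, \<dots>, n}\<close>.\<close>

definition NC :: "nat \<Rightarrow> nat \<Rightarrow> nat set set set" where
  "NC k m = {P. partition_on {..<m} P \<and> \<not> (\<exists>X\<subseteq>arcs P. crossing k X)}"

definition BNW :: "nat \<Rightarrow> nat \<Rightarrow> nat set set set" where
  "BNW k m = {P. partition_on {..<m} P \<and>
     \<not> (\<exists>X\<subseteq>black_arcs P. crossing k X) \<and> \<not> (\<exists>X\<subseteq>black_arcs P. weak_crossing k X)}"

end

theory Submission imports Defs
begin

text \<open>A partition is determined by its arcs other than loops, which form an arbitrary set of pairs
  \<open>i < j\<close> with distinct openers and distinct closers, and its number of blocks is the size of the
  ground set minus the number of these arcs. Loops never take part in an enhanced \<open>k\<close>-crossing with
  \<open>k \<ge> 2\<close>, so a partition in \<open>BNW\<close> is given by its red block \<open>R\<close> and its black arcs \<open>B\<close> other than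
  loops. Replace each black arc \<open>(i, j)\<close> by \<open>(i - 1, j)\<close> and each red element \<open>i > 0\<close> by the arc
  \<open>(i - 1, i)\<close>. The number of arcs is preserved, enhanced crossings of \<open>B\<close> become crossings, and the
  map is inverted by reading \<open>R\<close> off the arcs of length one.\<close>

section \<open>Partitions and arc systems\<close>

definition proper_arcs :: "nat set set \<Rightarrow> (nat \<times> nat) set" where
  "proper_arcs P = {(i, j). i < j \<and> (\<exists>B\<in>P. i \<in> B \<and> j \<in> B \<and> (\<forall>l\<in>B. \<not> (i < l \<and> l < j)))}"

text \<open>Distinct closers and distinct openers, encoded as single-valuedness of \<open>A\<close>
  and of its converse. Together with \<open>i < j\<close> this makes \<open>A\<close> a disjoint
  union of increasing paths.\<close>

definition arc_system :: "nat set \<Rightarrow> (nat \<times> nat) set \<Rightarrow> bool" where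
  "arc_system S A \<longleftrightarrow> A \<subseteq> S \<times> S \<and> (\<forall>(i, j)\<in>A. i < j) \<and> single_valued A \<and> single_valued (A\<inverse>)"

text \<open>Two points on one directed path are always comparable, so no zigzag closure is needed.
  Points of \<open>S\<close> that meet no arc form singleton classes, which replace the
  loops.\<close>

definition same_path :: "nat set \<Rightarrow> (nat \<times> nat) set \<Rightarrow> (nat \<times> nat) set" where
  "same_path S A = {(x, y). x \<in> S \<and> y \<in> S \<and> ((x, y) \<in> A\<^sup>* \<or> (y, x) \<in> A\<^sup>*)}"

definition paths :: "nat set \<Rightarrow> (nat \<times> nat) set \<Rightarrow> nat set set" where
  "paths S A = S // same_path S A"

section \<open>From a partition to its arcs\<close>

lemma partition_on_eq_block:
  assumes "partition_on S P" "B \<in> P" "C \<in> P" "x \<in> B" "x \<in> C"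
  shows "B = C"
  using assms disjointD[of P B C] unfolding partition_on_def by blast

lemma proper_arcs_unique_opener:
  assumes P: "partition_on S P" and a: "(i, j) \<in> proper_arcs P" and b: "(i', j) \<in> proper_arcs P"
  shows "i = i'"
proof -
  obtain B B' where B: "B \<in> P" "i \<in> B" "j \<in> B" "\<forall>l\<in>B. \<not> (i < l \<and> l < j)" "i < j"
    and B': "B' \<in> P" "i' \<in> B'" "j \<in> B'" "\<forall>l\<in>B'. \<not> (i' < l \<and> l < j)" "i' < j"
    using a b unfolding proper_arcs_def by blast
  have "B = B'" using partition_on_eq_block[OF P] B B' by blast
  then show ?thesis using B B' by (metis nat_neq_iff)
qed

lemma proper_arcs_unique_closer:
  assumes P: "partition_on S P" and a: "(i, j) \<in> proper_arcs P" and b: "(i, j') \<in> proper_arcs P"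
  shows "j = j'"
proof -
  obtain B B' where B: "B \<in> P" "i \<in> B" "j \<in> B" "\<forall>l\<in>B. \<not> (i < l \<and> l < j)" "i < j"
    and B': "B' \<in> P" "i \<in> B'" "j' \<in> B'" "\<forall>l\<in>B'. \<not> (i < l \<and> l < j')" "i < j'"
    using a b unfolding proper_arcs_def by blast
  have "B = B'" using partition_on_eq_block[OF P] B B' by blast
  then show ?thesis using B B' by (metis nat_neq_iff)
qed

lemma arc_system_proper_arcs:
  assumes "partition_on S P"
  shows "arc_system S (proper_arcs P)"
  unfolding arc_system_def
proof (intro conjI)
  show "proper_arcs P \<subseteq> S \<times> S"
    using assms by (auto simp: proper_arcs_def partition_on_def)
  show "\<forall>(i, j)\<in>proper_arcs P. i < j" by (auto simp: proper_arcs_def)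
  show "single_valued (proper_arcs P)" "single_valued ((proper_arcs P)\<inverse>)"
    using proper_arcs_unique_opener[OF assms] proper_arcs_unique_closer[OF assms]
    by (auto simp: single_valued_def)
qed

text \<open>Induction on \<open>j - i\<close>: a block element strictly between \<open>i\<close> and
  \<open>j\<close> splits the path into two shorter ones; if there is none, then
  \<open>i = j\<close> or \<open>(i, j)\<close> is itself an arc.\<close>

lemma proper_arcs_connect:
  assumes "B \<in> P" "i \<in> B" "j \<in> B" "i \<le> j"
  shows "(i, j) \<in> (proper_arcs P)\<^sup>*"
  using assms(2-)
proof (induction "j - i" arbitrary: i j rule: less_induct)
  case less
  show ?case
  proof (cases "\<exists>l\<in>B. i < l \<and> l < j")
    case True
    then obtain l where l: "l \<in> B" "i < l" "l < j" by blast
    have "(i, l) \<in> (proper_arcs P)\<^sup>*" "(l, j) \<in> (proper_arcs P)\<^sup>*"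
      using less.hyps[of l i] less.hyps[of j l] less.prems l by auto
    then show ?thesis by (rule rtrancl_trans)
  next
    case False
    then have "i = j \<or> (i, j) \<in> proper_arcs P"
      using less.prems assms(1) unfolding proper_arcs_def by (auto simp: le_less)
    then show ?thesis by auto
  qed
qed

lemma proper_arcs_rtrancl_block:
  assumes P: "partition_on S P" and B: "B \<in> P" and ij: "(i, j) \<in> (proper_arcs P)\<^sup>*"
  shows "i \<in> B \<longleftrightarrow> j \<in> B"
  using ij
proof (induction rule: rtrancl_induct)
  case (step y z)
  then obtain C where "C \<in> P" "y \<in> C" "z \<in> C" unfolding proper_arcs_def by blast
  then have "y \<in> B \<longleftrightarrow> z \<in> B"
    using partition_on_eq_block[OF P B] by blast
  with step show ?case by simp
qed simp

text \<open>Consecutive arcs link all elements of a block, and no arc leaves its block, so the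
  classes of \<open>same_path\<close> are exactly the blocks.\<close>

lemma paths_proper_arcs:
  assumes P: "partition_on S P"
  shows "paths S (proper_arcs P) = P"
proof -
  have eq: "same_path S (proper_arcs P) `` {x} = B" if B: "B \<in> P" and x: "x \<in> B" for B x
  proof -
    have sub: "B \<subseteq> S" using P B by (auto simp: partition_on_def)
    show ?thesis
    proof (intro set_eqI iffI)
      fix y assume "y \<in> same_path S (proper_arcs P) `` {x}"
      then show "y \<in> B"
        using proper_arcs_rtrancl_block[OF P B] x by (auto simp: same_path_def)
    next
      fix y assume y: "y \<in> B"
      show "y \<in> same_path S (proper_arcs P) `` {x}"
        using proper_arcs_connect[OF B x y] proper_arcs_connect[OF B y x] sub x y
        by (cases "x \<le> y") (auto simp: same_path_def)
    qed
  qed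
  show ?thesis
  proof (intro set_eqI iffI)
    fix B assume "B \<in> paths S (proper_arcs P)"
    then obtain x where x: "x \<in> S" "B = same_path S (proper_arcs P) `` {x}"
      by (auto simp: paths_def quotient_def)
    then obtain C where "C \<in> P" "x \<in> C" using P by (auto simp: partition_on_def)
    then show "B \<in> P" using eq x by simp
  next
    fix B assume B: "B \<in> P"
    then obtain x where x: "x \<in> B" "x \<in> S"
      using P by (auto simp: partition_on_def) (metis Union_iff ex_in_conv)
    then show "B \<in> paths S (proper_arcs P)"
      using eq[OF B] by (auto simp: paths_def quotient_def)
  qed
qed

section \<open>From an arc system back to a partition\<close>

text \<open>Only transitivity uses the shape of \<open>A\<close>: two points reachable from a common
  point are comparable because closers are determined by openers, and dually for two points that
  reach a common point.\<close>

lemma equiv_same_path: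
  assumes A: "arc_system S A"
  shows "equiv S (same_path S A)"
proof (rule equivI)
  show "same_path S A \<subseteq> S \<times> S" by (auto simp: same_path_def)
  show "refl_on S (same_path S A)" by (auto simp: refl_on_def same_path_def)
  show "sym (same_path S A)" by (auto simp: sym_def same_path_def)
  have fwd: "(y, z) \<in> A\<^sup>* \<or> (z, y) \<in> A\<^sup>*" if "(x, y) \<in> A\<^sup>*" "(x, z) \<in> A\<^sup>*" for x y z
    using single_valued_confluent that A by (metis arc_system_def)
  have bwd: "(y, z) \<in> A\<^sup>* \<or> (z, y) \<in> A\<^sup>*" if "(y, x) \<in> A\<^sup>*" "(z, x) \<in> A\<^sup>*" for x y z
    using single_valued_confluent[of "A\<inverse>" x y z] that A
    by (auto simp: arc_system_def rtrancl_converse)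
  show "trans (same_path S A)"
    unfolding trans_def same_path_def by (auto dest: fwd bwd intro: rtrancl_trans)
qed

lemma partition_on_paths:
  assumes "arc_system S A"
  shows "partition_on S (paths S A)"
  unfolding paths_def by (rule partition_on_quotient[OF equiv_same_path[OF assms]])

lemma arc_system_rtrancl_le:
  assumes A: "arc_system S A" and "(i, j) \<in> A\<^sup>*"
  shows "i \<le> j"
  using assms(2) by (induction rule: rtrancl_induct) (use A in \<open>auto simp: arc_system_def\<close>)

text \<open>A nontrivial path out of \<open>i\<close> must begin with the arc \<open>(i, j)\<close>,
  and paths never decrease.\<close>

lemma arc_system_no_between:
  assumes A: "arc_system S A" and ij: "(i, j) \<in> A" and il: "(i, l) \<in> A\<^sup>*" and "i < l"
  shows "j \<le> l"
proof -
  obtain y where y: "(i, y) \<in> A" "(y, l) \<in> A\<^sup>*"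
    using il \<open>i < l\<close> by (metis converse_rtranclE less_irrefl)
  then have "y = j" using A ij by (auto simp: arc_system_def single_valued_def)
  then show ?thesis using y arc_system_rtrancl_le[OF A] by auto
qed

lemma proper_arcs_paths:
  assumes A: "arc_system S A"
  shows "proper_arcs (paths S A) = A"
proof (intro set_eqI iffI; clarify)
  fix i j assume "(i, j) \<in> proper_arcs (paths S A)"
  then obtain B where B: "i < j" "B \<in> paths S A" "i \<in> B" "j \<in> B"
    "\<forall>l\<in>B. \<not> (i < l \<and> l < j)" unfolding proper_arcs_def by blast
  \<comment> \<open>The class \<open>B\<close> contains \<open>i\<close>, hence is the class of
    \<open>i\<close>. As \<open>i < j\<close>, the path joining them runs from \<open>i\<close> to
    \<open>j\<close>; its first vertex \<open>y\<close> lies in \<open>B\<close>, and minimality of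
    the gap forces \<open>y = j\<close>.\<close>
  have same: "(i, l) \<in> same_path S A \<longleftrightarrow> l \<in> B" for l
    using B equiv_same_path[OF A] unfolding paths_def
    by (metis quotient_eq_iff in_quotient_imp_closed)
  then have "(i, j) \<in> A\<^sup>*" and "i \<in> S"
    using B arc_system_rtrancl_le[OF A, of j i] by (auto simp: same_path_def)
  then obtain y where y: "(i, y) \<in> A" "(y, j) \<in> A\<^sup>*"
    using B(1) by (metis converse_rtranclE less_irrefl)
  have "y \<in> B" using y same[of y] \<open>i \<in> S\<close> A by (auto simp: same_path_def arc_system_def)
  moreover have "i < y" using y A by (auto simp: arc_system_def)
  moreover have "y \<le> j" using y arc_system_rtrancl_le[OF A] by auto
  ultimately have "y = j" using B(5) by (auto simp: le_less)
  then show "(i, j) \<in> A" using y by simp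
next
  fix i j assume ij: "(i, j) \<in> A"
  then have *: "i < j" "i \<in> S" "j \<in> S" using A by (auto simp: arc_system_def)
  define B where "B = same_path S A `` {i}"
  have "B \<in> paths S A" using * by (auto simp: B_def paths_def quotient_def)
  moreover have "i \<in> B" "j \<in> B" using * ij by (auto simp: B_def same_path_def)
  moreover have "\<not> (i < l \<and> l < j)" if "l \<in> B" for l
    using that arc_system_no_between[OF A ij, of l] arc_system_rtrancl_le[OF A, of l i]
    by (auto simp: B_def same_path_def)
  ultimately show "(i, j) \<in> proper_arcs (paths S A)"
    using * unfolding proper_arcs_def by blast
qed

text \<open>Every element that is not the minimum of its block closes exactly one arc.\<close>

lemma card_partition_arcs:
  assumes P: "partition_on S P" and fin: "finite S"
  shows "card P + card (proper_arcs P) = card S"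
proof -
  have finB: "finite B" "B \<noteq> {}" "B \<subseteq> S" if "B \<in> P" for B
    using that P fin by (auto simp: partition_on_def intro: finite_subset)
  have "inj_on Min P"
  proof (rule inj_onI)
    fix B C assume BC: "B \<in> P" "C \<in> P" "Min B = Min C"
    then have "Min B \<in> B" "Min B \<in> C" using finB by (metis Min_in)+
    then show "B = C" using partition_on_eq_block[OF P] BC by blast
  qed
  then have c1: "card (Min ` P) = card P" by (rule card_image)
  have "inj_on snd (proper_arcs P)"
    by (auto simp: inj_on_def dest: proper_arcs_unique_opener[OF P])
  then have c2: "card (snd ` proper_arcs P) = card (proper_arcs P)" by (rule card_image)
  have "Min ` P \<inter> snd ` proper_arcs P = {}"
  proof (rule ccontr)
    assume "Min ` P \<inter> snd ` proper_arcs P \<noteq> {}"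
    then obtain B i where B: "B \<in> P" "(i, Min B) \<in> proper_arcs P" by auto
    then obtain C where C: "C \<in> P" "i \<in> C" "Min B \<in> C" "i < Min B"
      unfolding proper_arcs_def by blast
    have "Min B \<in> B" using finB[OF B(1)] by simp
    then have "B = C" using partition_on_eq_block[OF P] B C by blast
    then show False using C finB[OF B(1)] by (simp add: Min_le leD)
  qed
  moreover have "Min ` P \<union> snd ` proper_arcs P = S"
  proof (intro set_eqI iffI)
    have "Min ` P \<subseteq> S" using finB Min_in by blast
    moreover have "proper_arcs P \<subseteq> S \<times> S"
      using arc_system_proper_arcs[OF P] by (simp add: arc_system_def)
    moreover fix x assume "x \<in> Min ` P \<union> snd ` proper_arcs P"
    ultimately show "x \<in> S" by auto
  next
    fix x assume "x \<in> S"
    then obtain B where B: "B \<in> P" "x \<in> B" using P by (auto simp: partition_on_def)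
    show "x \<in> Min ` P \<union> snd ` proper_arcs P"
    proof (cases "x = Min B")
      case False
      \<comment> \<open>\<open>Max L\<close> is the predecessor of \<open>x\<close> in its block;
        \<open>L\<close> is nonempty since it contains \<open>Min B\<close>.\<close>
      define L where "L = {l \<in> B. l < x}"
      have fL: "finite L" using finB[OF B(1)] by (simp add: L_def)
      have "Min B \<in> L" using False finB[OF B(1)] B by (simp add: L_def le_neq_implies_less)
      then have "Max L \<in> L" using fL by (metis Max_in empty_iff)
      moreover have "\<not> (Max L < l \<and> l < x)" if "l \<in> B" for l
        using that Max_ge[OF fL, of l] unfolding L_def by fastforce
      ultimately have "(Max L, x) \<in> proper_arcs P"
        using B unfolding proper_arcs_def L_def by blast
      then have "x \<in> snd ` proper_arcs P" by (metis image_eqI snd_conv)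
      then show ?thesis by blast
    next
      case True
      then show ?thesis using B(1) by blast
    qed
  qed
  ultimately have "card S = card (Min ` P) + card (snd ` proper_arcs P)"
    using fin by (metis card_Un_disjoint finite_Un)
  then show ?thesis using c1 c2 by simp
qed

section \<open>Crossings as pairs of sequences\<close>

definition has_crossing :: "nat \<Rightarrow> (nat \<times> nat) set \<Rightarrow> bool" where
  "has_crossing k A \<longleftrightarrow> (\<exists>i j :: nat \<Rightarrow> nat. strict_mono_on {1..k} i \<and> strict_mono_on {1..k} j \<and>
     i k < j 1 \<and> (\<forall>r\<in>{1..k}. (i r, j r) \<in> A))"

text \<open>The condition \<open>i k \<le> j 1\<close> merges crossings (strict case) and weak
  crossings (equality) into one notion, which the shift of openers turns into a strict
  inequality.\<close>

definition has_enhanced_crossing :: "nat \<Rightarrow> (nat \<times> nat) set \<Rightarrow> bool" where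
  "has_enhanced_crossing k A \<longleftrightarrow> (\<exists>i j :: nat \<Rightarrow> nat. strict_mono_on {1..k} i \<and> strict_mono_on {1..k} j \<and>
     i k \<le> j 1 \<and> (\<forall>r\<in>{1..k}. (i r, j r) \<in> A))"

lemma ex_crossing_iff: "(\<exists>X\<subseteq>A. crossing k X) \<longleftrightarrow> has_crossing k A"
proof
  assume "has_crossing k A"
  then obtain i j :: "nat \<Rightarrow> nat" where *: "strict_mono_on {1..k} i" "strict_mono_on {1..k} j" "i k < j 1"
    "\<forall>r\<in>{1..k}. (i r, j r) \<in> A" unfolding has_crossing_def by blast
  then have "(\<lambda>r. (i r, j r)) ` {1..k} \<subseteq> A" "crossing k ((\<lambda>r. (i r, j r)) ` {1..k})"
    by (auto simp: crossing_def)
  then show "\<exists>X\<subseteq>A. crossing k X" by blast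
qed (fastforce simp: crossing_def has_crossing_def)

lemma ex_enhanced_crossing_iff:
  "(\<exists>X\<subseteq>A. crossing k X) \<or> (\<exists>X\<subseteq>A. weak_crossing k X) \<longleftrightarrow> has_enhanced_crossing k A"
proof
  assume "has_enhanced_crossing k A"
  then obtain i j :: "nat \<Rightarrow> nat" where *: "strict_mono_on {1..k} i" "strict_mono_on {1..k} j" "i k \<le> j 1"
    "\<forall>r\<in>{1..k}. (i r, j r) \<in> A" unfolding has_enhanced_crossing_def by blast
  let ?X = "(\<lambda>r. (i r, j r)) ` {1..k}"
  have "?X \<subseteq> A" using * by auto
  moreover have "crossing k ?X \<or> weak_crossing k ?X"
    using * unfolding crossing_def weak_crossing_def by (metis le_neq_implies_less)
  ultimately show "(\<exists>X\<subseteq>A. crossing k X) \<or> (\<exists>X\<subseteq>A. weak_crossing k X)" by blast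
next
  assume "(\<exists>X\<subseteq>A. crossing k X) \<or> (\<exists>X\<subseteq>A. weak_crossing k X)"
  then obtain X i j where X: "X \<subseteq> A" and *: "strict_mono_on {1..k} i" "strict_mono_on {1..k} j"
    "i k \<le> j 1" "X = (\<lambda>r. (i r, j r)) ` {1..k}"
    unfolding crossing_def weak_crossing_def using less_imp_le le_refl by metis
  then show "has_enhanced_crossing k A" unfolding has_enhanced_crossing_def by blast
qed

text \<open>Since \<open>k \<ge> 2\<close>, the index \<open>r\<close> cannot be both
  \<open>1\<close> and \<open>k\<close>, so one of \<open>i r \<le> i k\<close> and
  \<open>j 1 \<le> j r\<close> is strict. With \<open>i k \<le> j 1\<close> this excludes loops;
  with \<open>i k < j 1\<close> it gives \<open>Suc (i r) < j r\<close> and so excludes arcs of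
  length one as well.\<close>

lemma strict_mono_on_arcs_spread:
  fixes i j :: "nat \<Rightarrow> nat"
  assumes "strict_mono_on {1..k} i" "strict_mono_on {1..k} j" "k \<ge> 2" "r \<in> {1..k}"
  shows "i r + j 1 < i k + j r"
proof -
  have "r = k \<or> i r < i k"
    using strict_mono_onD[OF assms(1), of r k] assms(3,4) by (cases "r < k") auto
  moreover have "r = 1 \<or> j 1 < j r"
    using strict_mono_onD[OF assms(2), of 1 r] assms(3,4) by (cases "1 < r") auto
  ultimately show ?thesis using assms(3) by auto
qed

section \<open>Removing loops and red arcs from the crossing conditions\<close>

lemma mem_arcs_iff: "i < j \<Longrightarrow> (i, j) \<in> arcs P \<longleftrightarrow> (i, j) \<in> proper_arcs P"
  unfolding arcs_def proper_arcs_def by auto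

lemma has_crossing_arcs:
  assumes "k \<ge> 2"
  shows "has_crossing k (arcs P) \<longleftrightarrow> has_crossing k (proper_arcs P)"
proof
  assume "has_crossing k (arcs P)"
  then obtain i j :: "nat \<Rightarrow> nat" where *: "strict_mono_on {1..k} i" "strict_mono_on {1..k} j" "i k < j 1"
    "\<forall>r\<in>{1..k}. (i r, j r) \<in> arcs P" unfolding has_crossing_def by blast
  have "(i r, j r) \<in> proper_arcs P" if r: "r \<in> {1..k}" for r
  proof -
    have "i r < j r" using strict_mono_on_arcs_spread[OF *(1,2) assms r] *(3) by linarith
    then show ?thesis using *(4) r mem_arcs_iff by blast
  qed
  then show "has_crossing k (proper_arcs P)" using * unfolding has_crossing_def by blast
next
  have "proper_arcs P \<subseteq> arcs P" unfolding arcs_def proper_arcs_def by blast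
  then show "has_crossing k (proper_arcs P) \<Longrightarrow> has_crossing k (arcs P)"
    unfolding has_crossing_def by blast
qed

lemma red_block_eq:
  assumes "partition_on S P" "R \<in> P" "0 \<in> R"
  shows "red_block P = R"
  unfolding red_block_def
  using assms partition_on_eq_block[OF assms(1)] by (intro the_equality) blast+

text \<open>A block that meets \<open>R\<close> equals \<open>R\<close>, so an arc avoids being red
  exactly when it comes from another block.\<close>

lemma mem_black_arcs_iff:
  assumes P: "partition_on S P" and R: "R \<in> P" "0 \<in> R" and ij: "i < j"
  shows "(i, j) \<in> black_arcs P \<longleftrightarrow> (i, j) \<in> proper_arcs (P - {R})"
proof -
  have "B = R" if "B \<in> P" "i \<in> B" "i \<in> R" for B
    using that partition_on_eq_block[OF P] R by blast
  then show ?thesis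
    using ij R unfolding black_arcs_def red_arcs_def red_block_eq[OF P R] arcs_def proper_arcs_def
    by blast
qed

lemma has_enhanced_crossing_black_arcs:
  assumes k: "k \<ge> 2" and P: "partition_on S P" "R \<in> P" "0 \<in> R"
  shows "has_enhanced_crossing k (black_arcs P) \<longleftrightarrow> has_enhanced_crossing k (proper_arcs (P - {R}))"
proof -
  have "(i r, j r) \<in> black_arcs P \<longleftrightarrow> (i r, j r) \<in> proper_arcs (P - {R})"
    if "strict_mono_on {1..k} i" "strict_mono_on {1..k} j" "i k \<le> j 1" "r \<in> {1..k}"
    for i j :: "nat \<Rightarrow> nat" and r
  proof -
    have "i r < j r" using strict_mono_on_arcs_spread[OF that(1,2) k that(4)] that(3) by linarith
    then show ?thesis by (rule mem_black_arcs_iff[OF P])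
  qed
  then show ?thesis unfolding has_enhanced_crossing_def by blast
qed

section \<open>Shifting the openers\<close>

text \<open>Writing \<open>(Suc i, j) \<in> B\<close> avoids truncated subtraction. It would lose an
  arc with opener \<open>0\<close>, but black arcs have none because \<open>0\<close> is
  red.\<close>

definition shift_arcs :: "nat set \<times> (nat \<times> nat) set \<Rightarrow> (nat \<times> nat) set" where
  "shift_arcs = (\<lambda>(R, B). {(i, j). (Suc i, j) \<in> B} \<union> {(i, Suc i) | i. Suc i \<in> R})"

text \<open>The element \<open>0\<close> is inserted by hand: it is always red but is encoded by no
  arc.\<close>

definition unshift_arcs :: "(nat \<times> nat) set \<Rightarrow> nat set \<times> (nat \<times> nat) set" where
  "unshift_arcs A = (insert 0 {Suc i | i. (i, Suc i) \<in> A},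
                     {(Suc i, j) | i j. (i, j) \<in> A \<and> Suc i < j})"

definition red_black_systems :: "nat \<Rightarrow> (nat set \<times> (nat \<times> nat) set) set" where
  "red_black_systems m = {(R, B). 0 \<in> R \<and> R \<subseteq> {..<m} \<and> arc_system ({..<m} - R) B}"

lemma mem_shift_arcs_iff:
  "(i, j) \<in> shift_arcs (R, B) \<longleftrightarrow> (Suc i, j) \<in> B \<or> j = Suc i \<and> j \<in> R"
  by (auto simp: shift_arcs_def)

lemma red_black_systemsD:
  assumes "(R, B) \<in> red_black_systems m" "(i, j) \<in> B"
  shows "0 < i" "i < j" "j < m" "i \<notin> R" "j \<notin> R"
proof -
  have "i \<notin> R" "0 \<in> R" using assms by (auto simp: red_black_systems_def arc_system_def)
  then show "0 < i" "i \<notin> R" by (auto intro: gr0I)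
qed (use assms in \<open>auto simp: red_black_systems_def arc_system_def\<close>)

text \<open>A clash could only occur between a shifted black arc and a short arc
  \<open>(i, Suc i)\<close>. A common opener \<open>i\<close> would make \<open>Suc i\<close> both
  black and red, and a common closer would likewise have both colours.\<close>

lemma arc_system_shift_arcs:
  assumes RB: "(R, B) \<in> red_black_systems m"
  shows "arc_system {..<m} (shift_arcs (R, B))"
proof -
  have R: "\<And>i. i \<in> R \<Longrightarrow> i < m"
    and det: "\<And>i j j'. (i, j) \<in> B \<Longrightarrow> (i, j') \<in> B \<Longrightarrow> j = j'"
    "\<And>i i' j. (i, j) \<in> B \<Longrightarrow> (i', j) \<in> B \<Longrightarrow> i = i'"
    using RB by (auto simp: red_black_systems_def arc_system_def single_valued_def)
  note B = red_black_systemsD[OF RB]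
  show ?thesis
    unfolding arc_system_def
  proof (intro conjI)
    show "shift_arcs (R, B) \<subseteq> {..<m} \<times> {..<m}"
    proof clarify
      fix i j assume "(i, j) \<in> shift_arcs (R, B)"
      then have "i < j \<and> j < m" using B(2,3)[of "Suc i" j] R[of j] by (auto simp: mem_shift_arcs_iff)
      then show "i \<in> {..<m} \<and> j \<in> {..<m}" by auto
    qed
    show "\<forall>(i, j)\<in>shift_arcs (R, B). i < j"
      using B(2) by (fastforce simp: mem_shift_arcs_iff)
    show "single_valued (shift_arcs (R, B))"
      by (auto simp: single_valued_def mem_shift_arcs_iff dest: B(4) det(1))
    show "single_valued ((shift_arcs (R, B))\<inverse>)"
      by (auto simp: single_valued_def mem_shift_arcs_iff dest: B(5) det(2))
  qed
qed

lemma unshift_arcs_mem: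
  assumes A: "arc_system {..<m} A" and "m > 0"
  shows "unshift_arcs A \<in> red_black_systems m"
proof -
  let ?R = "insert 0 {Suc i | i. (i, Suc i) \<in> A}"
  let ?B = "{(Suc i, j) | i j. (i, j) \<in> A \<and> Suc i < j}"
  have lt: "\<And>i j. (i, j) \<in> A \<Longrightarrow> j < m"
    and det: "\<And>i j j'. (i, j) \<in> A \<Longrightarrow> (i, j') \<in> A \<Longrightarrow> j = j'"
    "\<And>i i' j. (i, j) \<in> A \<Longrightarrow> (i', j) \<in> A \<Longrightarrow> i = i'"
    using A by (auto simp: arc_system_def single_valued_def)
  have "?R \<subseteq> {..<m}" using lt assms(2) by blast
  moreover have "arc_system ({..<m} - ?R) ?B"
    unfolding arc_system_def
  proof (intro conjI)
    have "Suc i < m \<and> j < m \<and> Suc i \<notin> ?R \<and> j \<notin> ?R" if ij: "(i, j) \<in> A" "Suc i < j" for i j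
    proof -
      \<comment> \<open>If \<open>Suc i\<close> were red, \<open>(i, Suc i)\<close> would be a
        second arc of \<open>A\<close> with opener \<open>i\<close>; if \<open>j\<close> were red,
        \<open>(j - 1, j)\<close> would be a second arc with closer \<open>j\<close>.\<close>
      have "Suc i \<notin> ?R" using det(1)[OF ij(1), of "Suc i"] ij(2) by auto
      moreover have "j \<notin> ?R" using det(2)[OF ij(1), of "j - 1"] ij(2) by auto
      ultimately show ?thesis using lt[OF ij(1)] ij(2) by simp
    qed
    then show "?B \<subseteq> ({..<m} - ?R) \<times> ({..<m} - ?R)" by blast
    show "\<forall>(i, j)\<in>?B. i < j" by blast
    show "single_valued ?B" using det(1) unfolding single_valued_def by blast
    show "single_valued (?B\<inverse>)" using det(2) unfolding single_valued_def by blast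
  qed
  ultimately show ?thesis by (simp add: red_black_systems_def unshift_arcs_def)
qed

lemma shift_unshift_arcs:
  assumes "arc_system {..<m} A"
  shows "shift_arcs (unshift_arcs A) = A"
proof -
  have "(i, j) \<in> shift_arcs (unshift_arcs A) \<longleftrightarrow> (i, j) \<in> A" for i j
  proof -
    have "(i, j) \<in> shift_arcs (unshift_arcs A) \<longleftrightarrow> (i, j) \<in> A \<and> (Suc i < j \<or> j = Suc i)"
      unfolding unshift_arcs_def mem_shift_arcs_iff by blast
    moreover have "(i, j) \<in> A \<Longrightarrow> i < j" using assms by (auto simp: arc_system_def)
    ultimately show ?thesis by (metis Suc_lessI)
  qed
  then show ?thesis by auto
qed

text \<open>A black arc has length at least one, so its shift has length at least two and is never
  mistaken for the short arc of a red element.\<close>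

lemma unshift_shift_arcs:
  assumes RB: "(R, B) \<in> red_black_systems m"
  shows "unshift_arcs (shift_arcs (R, B)) = (R, B)"
proof -
  have "0 \<in> R" using RB by (simp add: red_black_systems_def)
  note * = red_black_systemsD[OF RB]
  have "x \<in> fst (unshift_arcs (shift_arcs (R, B))) \<longleftrightarrow> x \<in> R" for x
    using \<open>0 \<in> R\<close> *(2) by (cases x) (auto simp: unshift_arcs_def mem_shift_arcs_iff)
  then have "fst (unshift_arcs (shift_arcs (R, B))) = R" by blast
  moreover have "(x, y) \<in> snd (unshift_arcs (shift_arcs (R, B))) \<longleftrightarrow> (x, y) \<in> B" for x y
    using *(1,2)[of x y] by (cases x) (auto simp: unshift_arcs_def mem_shift_arcs_iff)
  then have "snd (unshift_arcs (shift_arcs (R, B))) = B" by auto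
  ultimately show ?thesis by (metis prod.collapse)
qed

text \<open>The \<open>Suc\<close> accounts for \<open>0\<close>, the only red element without an
  arc.\<close>

lemma card_shift_arcs:
  assumes RB: "(R, B) \<in> red_black_systems m"
  shows "Suc (card (shift_arcs (R, B))) = card R + card B"
proof -
  have *: "0 \<in> R" "R \<subseteq> {..<m}" "B \<subseteq> {..<m} \<times> {..<m}"
    using RB by (auto simp: red_black_systems_def arc_system_def)
  have fin: "finite R" "finite B"
    using *(2,3) by (auto intro: finite_subset)
  note B = red_black_systemsD[OF RB]
  \<comment> \<open>\<open>C\<close> holds the shifted black arcs, of length at least two, and
    \<open>D\<close> the short arcs of the nonzero red elements, so the two are disjoint.\<close>
  define C where "C = {(i, j). (Suc i, j) \<in> B}"
  define D where "D = {(i, Suc i) | i. Suc i \<in> R}"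
  have "(i, j) \<in> B \<longleftrightarrow> (i, j) \<in> map_prod Suc id ` C" for i j
    using B(1)[of i j] by (cases i) (auto simp: C_def image_iff)
  then have eq1: "B = map_prod Suc id ` C" by auto
  have inj1: "inj_on (map_prod Suc id) C" by (auto simp: inj_on_def)
  have "x \<in> R - {0} \<longleftrightarrow> x \<in> snd ` D" for x
    by (cases x) (auto simp: D_def image_iff)
  then have eq2: "R - {0} = snd ` D" by blast
  have inj2: "inj_on snd D" by (auto simp: inj_on_def D_def)
  have finCD: "finite C" "finite D"
    using fin finite_imageD[OF _ inj1] finite_imageD[OF _ inj2] eq1 eq2 by (metis finite_Diff)+
  have c1: "card C = card B" using card_image[OF inj1] eq1 by simp
  have "card D = card (R - {0})" using card_image[OF inj2] eq2 by simp
  then have c2: "Suc (card D) = card R" using *(1) fin(1) by (metis card_Suc_Diff1)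
  have "C \<inter> D = {}" using B(2) by (auto simp: C_def D_def)
  then have "card (C \<union> D) = card C + card D" using finCD by (rule card_Un_disjoint[rotated 2])
  moreover have "shift_arcs (R, B) = C \<union> D" by (simp add: shift_arcs_def C_def D_def)
  ultimately show ?thesis using c1 c2 by simp
qed

text \<open>The arcs \<open>(i - 1, i)\<close> coming from red elements are too short to take part in a \<open>k\<close>-crossing
  with \<open>k \<ge> 2\<close>.\<close>

lemma has_crossing_shift_arcs:
  assumes k: "k \<ge> 2" and RB: "(R, B) \<in> red_black_systems m"
  shows "has_crossing k (shift_arcs (R, B)) \<longleftrightarrow> has_enhanced_crossing k B"
proof
  assume "has_crossing k (shift_arcs (R, B))"
  then obtain i j :: "nat \<Rightarrow> nat" where *: "strict_mono_on {1..k} i" "strict_mono_on {1..k} j" "i k < j 1"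
    "\<forall>r\<in>{1..k}. (i r, j r) \<in> shift_arcs (R, B)" unfolding has_crossing_def by blast
  have "(Suc (i r), j r) \<in> B" if r: "r \<in> {1..k}" for r
  proof -
    have "Suc (i r) < j r" using strict_mono_on_arcs_spread[OF *(1,2) k r] *(3) by linarith
    then show ?thesis using *(4) r by (auto simp: mem_shift_arcs_iff)
  qed
  moreover have "strict_mono_on {1..k} (\<lambda>r. Suc (i r))" using *(1) by (auto simp: strict_mono_on_def)
  ultimately show "has_enhanced_crossing k B"
    using *(2,3) unfolding has_enhanced_crossing_def
    by (intro exI[of _ "\<lambda>r. Suc (i r)"] exI[of _ j]) auto
next
  assume "has_enhanced_crossing k B"
  then obtain i j :: "nat \<Rightarrow> nat" where *: "strict_mono_on {1..k} i" "strict_mono_on {1..k} j" "i k \<le> j 1"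
    "\<forall>r\<in>{1..k}. (i r, j r) \<in> B" unfolding has_enhanced_crossing_def by blast
  \<comment> \<open>Positivity of the openers makes \<open>i r - 1\<close> a genuine predecessor: it
    keeps the sequence strictly increasing and turns \<open>i k \<le> j 1\<close> into
    \<open>i k - 1 < j 1\<close>.\<close>
  have pos: "i r > 0" if "r \<in> {1..k}" for r
    using *(4) that red_black_systemsD(1)[OF RB] by blast
  have "strict_mono_on {1..k} (\<lambda>r. i r - 1)"
    using *(1) pos unfolding strict_mono_on_def by (metis Suc_leI One_nat_def diff_less_mono)
  moreover have "i k - 1 < j 1" using pos[of k] *(3) k by auto
  moreover have "(i r - 1, j r) \<in> shift_arcs (R, B)" if "r \<in> {1..k}" for r
    using *(4) pos that by (simp add: mem_shift_arcs_iff)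
  ultimately show "has_crossing k (shift_arcs (R, B))"
    using *(2) unfolding has_crossing_def by blast
qed

section \<open>The bijection\<close>

lemma NC_iff:
  assumes "k \<ge> 2"
  shows "P \<in> NC k m \<longleftrightarrow> partition_on {..<m} P \<and> \<not> has_crossing k (proper_arcs P)"
  using has_crossing_arcs[OF assms] by (simp add: NC_def ex_crossing_iff)

lemma BNW_iff:
  assumes "k \<ge> 2" "R \<in> P" "0 \<in> R"
  shows "P \<in> BNW k m \<longleftrightarrow>
    partition_on {..<m} P \<and> \<not> has_enhanced_crossing k (proper_arcs (P - {R}))"
  using has_enhanced_crossing_black_arcs[OF assms(1) _ assms(2,3)]
    ex_enhanced_crossing_iff[of "black_arcs P" k]
  by (auto simp: BNW_def)

lemma bij_betw_paths_NC:
  assumes "k \<ge> 2"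
  shows "bij_betw (paths {..<m}) {A. arc_system {..<m} A \<and> \<not> has_crossing k A} (NC k m)"
  by (rule bij_betw_byWitness[where f' = proper_arcs])
    (auto simp: NC_iff[OF assms] proper_arcs_paths paths_proper_arcs partition_on_paths
      arc_system_proper_arcs)

lemma bij_betw_shift_arcs:
  assumes "k \<ge> 2" "m > 0"
  shows "bij_betw shift_arcs {(R, B) \<in> red_black_systems m. \<not> has_enhanced_crossing k B}
    {A. arc_system {..<m} A \<and> \<not> has_crossing k A}"
proof (rule bij_betw_byWitness[where f' = unshift_arcs])
  show "\<forall>x\<in>{(R, B) \<in> red_black_systems m. \<not> has_enhanced_crossing k B}. unshift_arcs (shift_arcs x) = x"
    using unshift_shift_arcs by blast
  show "\<forall>A\<in>{A. arc_system {..<m} A \<and> \<not> has_crossing k A}. shift_arcs (unshift_arcs A) = A"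
    using shift_unshift_arcs by blast
  show "shift_arcs ` {(R, B) \<in> red_black_systems m. \<not> has_enhanced_crossing k B}
    \<subseteq> {A. arc_system {..<m} A \<and> \<not> has_crossing k A}"
    using arc_system_shift_arcs has_crossing_shift_arcs[OF assms(1)] by blast
  show "unshift_arcs ` {A. arc_system {..<m} A \<and> \<not> has_crossing k A}
    \<subseteq> {(R, B) \<in> red_black_systems m. \<not> has_enhanced_crossing k B}"
  proof clarify
    fix A R B assume A: "arc_system {..<m} A" "\<not> has_crossing k A" and RB: "(R, B) = unshift_arcs A"
    have "(R, B) \<in> red_black_systems m" using unshift_arcs_mem[OF A(1) assms(2)] RB by simp
    \<comment> \<open>Through this identity the absence of crossings in \<open>A\<close> becomes the
      absence of enhanced crossings in \<open>B\<close>.\<close>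
    moreover have "shift_arcs (R, B) = A" using shift_unshift_arcs[OF A(1)] RB by simp
    ultimately show "(R, B) \<in> red_black_systems m \<and> \<not> has_enhanced_crossing k B"
      using A(2) has_crossing_shift_arcs[OF assms(1)] by blast
  qed
qed

section \<open>Splitting off the red block and counting blocks\<close>

definition red_black :: "nat set set \<Rightarrow> nat set \<times> (nat \<times> nat) set" where
  "red_black P = (red_block P, proper_arcs (P - {red_block P}))"

lemma red_block_mem:
  assumes P: "partition_on {..<m} P" and "m > 0"
  shows "red_block P \<in> P" "0 \<in> red_block P"
proof -
  obtain R where "R \<in> P" "0 \<in> R" using assms by (auto simp: partition_on_def)
  then show "red_block P \<in> P" "0 \<in> red_block P" using red_block_eq[OF P] by auto
qed

lemma partition_on_minus_block:
  assumes "partition_on S P" "R \<in> P"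
  shows "partition_on (S - R) (P - {R})"
  using assms by (auto simp: partition_on_def disjoint_def)

lemma red_black_mem:
  assumes P: "partition_on {..<m} P" and "m > 0"
  shows "red_black P \<in> red_black_systems m"
proof -
  note R = red_block_mem[OF assms]
  have "arc_system ({..<m} - red_block P) (proper_arcs (P - {red_block P}))"
    by (rule arc_system_proper_arcs[OF partition_on_minus_block[OF P R(1)]])
  moreover have "red_block P \<subseteq> {..<m}" using P R(1) by (auto simp: partition_on_def)
  ultimately show ?thesis using R(2) by (simp add: red_black_def red_black_systems_def)
qed

lemma bij_betw_red_black:
  assumes k: "k \<ge> 2" and m: "m > 0"
  shows "bij_betw red_black (BNW k m) {(R, B) \<in> red_black_systems m. \<not> has_enhanced_crossing k B}"
\<comment> \<open>The inverse rebuilds the black blocks as paths on the complement of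
  \<open>R\<close> and adds \<open>R\<close> back.\<close>
proof (rule bij_betw_byWitness[where f' = "\<lambda>(R, B). insert R (paths ({..<m} - R) B)"])
  have part: "partition_on {..<m} P" if "P \<in> BNW k m" for P
    using that by (simp add: BNW_def)
  show "\<forall>P\<in>BNW k m. (\<lambda>(R, B). insert R (paths ({..<m} - R) B)) (red_black P) = P"
    using red_block_mem[OF part m] paths_proper_arcs[OF partition_on_minus_block[OF part]]
    by (auto simp: red_black_def)
  show "red_black ` BNW k m \<subseteq> {(R, B) \<in> red_black_systems m. \<not> has_enhanced_crossing k B}"
    using red_black_mem[OF part m] BNW_iff[OF k red_block_mem[OF part m]]
    by (auto simp: red_black_def)
  have inv: "insert R (paths ({..<m} - R) B) \<in> BNW k m \<and>
      red_black (insert R (paths ({..<m} - R) B)) = (R, B)"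
    if RB: "(R, B) \<in> red_black_systems m" "\<not> has_enhanced_crossing k B" for R B
  proof -
    let ?Q = "paths ({..<m} - R) B"
    let ?P = "insert R ?Q"
    have R: "0 \<in> R" "R \<subseteq> {..<m}" and B: "arc_system ({..<m} - R) B"
      using RB(1) by (auto simp: red_black_systems_def)
    have Q: "partition_on ({..<m} - R) ?Q" by (rule partition_on_paths[OF B])
    \<comment> \<open>\<open>R\<close> contains \<open>0\<close>, whereas the blocks of
      \<open>?Q\<close> lie outside \<open>R\<close>; hence deleting \<open>R\<close> from
      \<open>?P\<close> recovers \<open>?Q\<close>.\<close>
    then have "R \<notin> ?Q" using R by (auto simp: partition_on_def)
    then have eq: "?P - {R} = ?Q" by blast
    have P: "partition_on {..<m} ?P"
      using Q R by (auto simp: partition_on_def disjoint_def)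
    have red: "red_block ?P = R" by (rule red_block_eq[OF P]) (use R in auto)
    have "proper_arcs (?P - {R}) = B" unfolding eq by (rule proper_arcs_paths[OF B])
    then show ?thesis
      using BNW_iff[OF k, of R ?P m] P R RB(2) red by (simp add: red_black_def)
  qed
  show "\<forall>x\<in>{(R, B) \<in> red_black_systems m. \<not> has_enhanced_crossing k B}.
      red_black ((\<lambda>(R, B). insert R (paths ({..<m} - R) B)) x) = x"
    using inv by auto
  show "(\<lambda>(R, B). insert R (paths ({..<m} - R) B)) `
      {(R, B) \<in> red_black_systems m. \<not> has_enhanced_crossing k B} \<subseteq> BNW k m"
    using inv by auto
qed

text \<open>The black blocks number \<open>card P - 1\<close>, and with the black arcs they make up
  \<open>m - card ?R\<close>. The shift adds one arc for each of the \<open>card ?R - 1\<close>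
  nonzero red elements, so the total is \<open>m\<close>.\<close>

lemma card_red_black:
  assumes P: "partition_on {..<m} P" and m: "m > 0"
  shows "card P + card (shift_arcs (red_black P)) = m"
proof -
  let ?R = "red_block P"
  let ?B = "proper_arcs (P - {?R})"
  note R = red_block_mem[OF P m]
  have finP: "finite P" using P by (metis finite_elements finite_lessThan)
  have sub: "?R \<subseteq> {..<m}" using P R by (auto simp: partition_on_def)
  have "card (P - {?R}) + card ?B = card ({..<m} - ?R)"
    by (rule card_partition_arcs[OF partition_on_minus_block[OF P R(1)]]) simp
  moreover have "card ({..<m} - ?R) + card ?R = m"
    using sub by (metis card_Diff_subset card_lessThan card_mono finite_lessThan finite_subset le_add_diff_inverse2)
  moreover have "Suc (card (P - {?R})) = card P" using finP R(1) by (metis card_Suc_Diff1)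
  moreover have "Suc (card (shift_arcs (?R, ?B))) = card ?R + card ?B"
    using card_shift_arcs red_black_mem[OF P m] by (simp add: red_black_def)
  ultimately show ?thesis by (simp add: red_black_def)
qed

theorem theorem3p1:
  fixes n k :: nat
  assumes "k \<ge> 2"
  shows "(\<exists>\<Phi>. bij_betw \<Phi> (BNW k (n + 1)) (NC k (n + 1)) \<and>
            (\<forall>P\<in>BNW k (n + 1). card (\<Phi> P) = card P)) \<and>
         (\<Sum>P\<in>BNW k (n + 1). monom (1::int) (card P)) =
         (\<Sum>P\<in>NC k (n + 1). monom (1::int) (card P))"
proof -
  define \<Phi> where "\<Phi> = paths {..<n + 1} \<circ> (shift_arcs \<circ> red_black)"
  have bij: "bij_betw \<Phi> (BNW k (n + 1)) (NC k (n + 1))"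
    unfolding \<Phi>_def
    by (rule bij_betw_trans[OF bij_betw_trans[OF bij_betw_red_black[OF assms]
          bij_betw_shift_arcs[OF assms]] bij_betw_paths_NC[OF assms]]) simp_all
  have card: "card (\<Phi> P) = card P" if "P \<in> BNW k (n + 1)" for P
  proof -
    have P: "partition_on {..<n + 1} P" using that by (simp add: BNW_def)
    let ?A = "shift_arcs (red_black P)"
    have A: "arc_system {..<n + 1} ?A"
      using red_black_mem[OF P] arc_system_shift_arcs by (cases "red_black P") auto
    \<comment> \<open>The proper arcs of \<open>\<Phi> P\<close> are exactly \<open>?A\<close>, so
      both partitions have \<open>n + 1\<close> minus \<open>card ?A\<close> blocks.\<close>
    have "card (\<Phi> P) + card ?A = n + 1"
      using card_partition_arcs[OF partition_on_paths[OF A]] proper_arcs_paths[OF A]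
      by (simp add: \<Phi>_def)
    then show ?thesis using card_red_black[OF P] by simp
  qed
  have "(\<Sum>P\<in>BNW k (n + 1). monom (1::int) (card (\<Phi> P))) =
      (\<Sum>P\<in>NC k (n + 1). monom (1::int) (card P))"
    by (rule sum.reindex_bij_betw[OF bij])
  then show ?thesis using bij card by auto
qed

end
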